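(* For every instance of the online inventory problem without rate constraints, the algorithm BatMan (with the reservation function and $\alpha$ given in the context) produces a feasible solution: for all $t$, $x(t)\ge0$, $x(t)\ge d(t)-b(t-1)$, and $0\le b(t)\le B$.
   Context: Online inventory problem (without rate constraints). Time slots $t=1,\dots,T$. At each slot a price $p(t)\in[p_{\min},p_{\max}]$ ($0<p_{\min}<p_{\max}$ known) and a demand $d(t)\ge0$ are revealed; the decision maker chooses $x(t)\ge0$ online; the inventory level is $b(t)=b(t-1)+x(t)-d(t)$ with $b(0)=0$; $B>0$ is the inventory capacity. Let $\theta=p_{\max}/p_{\min}$ and $\alpha=\left(W\!\left(-\frac{\theta-1}{\theta e}\right)+1\right)^{-1}$, $W$ the principal branch of the Lambert-$W$ function (inverse of $z e^z$). For $B'>0$ let $G_{B'}(p)=\alpha B'\ln\left[\left(1-\frac{p}{p_{\max}}\right)\frac{\alpha}{\alpha-1}\right]$ for $p\in[p_{\min},p_{\max}/\alpha]$ and $G_{B'}(p)=0$ for $p\ge p_{\max}/\alpha$. Algorithm BatMan: maintain virtual storages $i=1,\dots,v$ with capacities $B_i$ and reservation prices $\xi_i$; initially $v=1$, $B_1=B$, $\xi_1=p_{\max}/\alpha$. At each slot $t$: (1) if $d(t)>0$, set $v\leftarrow v+1$, $B_v\leftarrow d(t)$, $\xi_v\leftarrow p_{\max}/\alpha$; (2) for all $i\le v$, $x_i(t)=[G_{B_i}(p(t))-G_{B_i}(\xi_i)]^+$, then $\xi_i\leftarrow\min\{p(t),\xi_i\}$; (3) $x(t)=\max\{\sum_{i=1}^v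 x_i(t),[d(t)-b(t-1)]^+\}$, $b(t)=b(t-1)+x(t)-d(t)$; (4) if $b(t)=0$, reset $v\leftarrow1$, $\xi_1\leftarrow p_{\max}/\alpha$. *)

theory Defs
  imports Complex_Main
begin

text \<open>Principal branch of the Lambert W function; meaningful for \<open>x \<ge> - exp (- 1)\<close>.\<close>

definition lambert_W :: "real \<Rightarrow> real" where
  "lambert_W x = (THE w. - 1 \<le> w \<and> w * exp w = x)"

definition comp_ratio :: "real \<Rightarrow> real \<Rightarrow> real" where
  "comp_ratio pmin pmax =
     (let \<theta> = pmax / pmin in inverse (lambert_W (- ((\<theta> - 1) / (\<theta> * exp 1))) + 1))"

text \<open>
  The two branches agree at \<open>p = pmax / \<alpha>\<close>. The function is only relevant for
  \<open>p \<ge> pmin\<close>; no separate case is made for smaller prices.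
\<close>

definition reserve :: "real \<Rightarrow> real \<Rightarrow> real \<Rightarrow> real \<Rightarrow> real" where
  "reserve pmin pmax B' p =
     (let \<alpha> = comp_ratio pmin pmax in
      if p \<le> pmax / \<alpha> then \<alpha> * B' * ln ((1 - p / pmax) * (\<alpha> / (\<alpha> - 1))) else 0)"

text \<open>
  State of BatMan at the end of a slot: inventory level, number \<open>v\<close> of virtual storages,
  and their capacities and reservation prices. The latter two are meaningful only at
  indices \<open>1, \<dots>, v\<close>; other entries are overwritten before they are read.
\<close>

record bm_state =
  level :: real
  num :: nat
  cap :: "nat \<Rightarrow> real"
  resv :: "nat \<Rightarrow> real"

definition batman_init :: "real \<Rightarrow> real \<Rightarrow> real \<Rightarrow> bm_state" where
  "batman_init pmin pmax B =
     \<lparr>level = 0, num = 1, cap = (\<lambda>_. B), resv = (\<lambda>_. pmax / comp_ratio pmin pmax)\<rparr>"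

text \<open>
  One slot with price \<open>pt\<close> and demand \<open>dt\<close>: the purchase made, and the new state.
  A reset leaves the capacity of storage 1 alone; it is never modified after initialisation.
\<close>

definition batman_step ::
  "real \<Rightarrow> real \<Rightarrow> real \<Rightarrow> real \<Rightarrow> bm_state \<Rightarrow> real \<times> bm_state" where
  "batman_step pmin pmax pt dt s =
     (let \<xi>0 = pmax / comp_ratio pmin pmax;
          v = (if dt > 0 then num s + 1 else num s);
          C = (if dt > 0 then (cap s)(v := dt) else cap s);
          \<xi> = (if dt > 0 then (resv s)(v := \<xi>0) else resv s);
          y = (\<lambda>i. max 0 (reserve pmin pmax (C i) pt - reserve pmin pmax (C i) (\<xi> i)));
          \<xi>' = (\<lambda>i. if i \<in> {1..v} then min pt (\<xi> i) else \<xi> i);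
          x = max (\<Sum>i=1..v. y i) (max 0 (dt - level s));
          b = level s + x - dt
      in (x, if b = 0
             then \<lparr>level = b, num = 1, cap = C, resv = \<xi>'(1 := \<xi>0)\<rparr>
             else \<lparr>level = b, num = v, cap = C, resv = \<xi>'\<rparr>))"

primrec batman_state ::
  "real \<Rightarrow> real \<Rightarrow> real \<Rightarrow> (nat \<Rightarrow> real) \<Rightarrow> (nat \<Rightarrow> real) \<Rightarrow> nat \<Rightarrow> bm_state" where
  "batman_state pmin pmax B p d 0 = batman_init pmin pmax B"
| "batman_state pmin pmax B p d (Suc t) =
     snd (batman_step pmin pmax (p (Suc t)) (d (Suc t)) (batman_state pmin pmax B p d t))"

text \<open>The purchase in slot \<open>t\<close>; slots are numbered from 1, so the value at 0 is irrelevant.\<close>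

definition batman ::
  "real \<Rightarrow> real \<Rightarrow> real \<Rightarrow> (nat \<Rightarrow> real) \<Rightarrow> (nat \<Rightarrow> real) \<Rightarrow> nat \<Rightarrow> real" where
  "batman pmin pmax B p d t =
     fst (batman_step pmin pmax (p t) (d t) (batman_state pmin pmax B p d (t - 1)))"

text \<open>The inventory level of the problem, for an arbitrary purchase sequence \<open>x\<close>.\<close>

primrec inventory :: "(nat \<Rightarrow> real) \<Rightarrow> (nat \<Rightarrow> real) \<Rightarrow> nat \<Rightarrow> real" where
  "inventory d x 0 = 0"
| "inventory d x (Suc t) = inventory d x t + x (Suc t) - d (Suc t)"

definition feasible :: "real \<Rightarrow> nat \<Rightarrow> (nat \<Rightarrow> real) \<Rightarrow> (nat \<Rightarrow> real) \<Rightarrow> bool" where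
  "feasible B T d x \<longleftrightarrow>
     (\<forall>t\<in>{1..T}. x t \<ge> 0 \<and> x t \<ge> d t - inventory d x (t - 1) \<and>
                 0 \<le> inventory d x t \<and> inventory d x t \<le> B)"

end

theory Submission imports Defs begin

text \<open>
  As long as no reset occurs, the purchase equals the sum of the virtual purchases, since a purchase
  forced by the demand empties the inventory; a reset makes both level and virtual contents zero.
  Hence the inventory level is always
  \<open>\<Sum>i=1..v. G\<^bsub>B\<^sub>i\<^esub>(\<xi>\<^sub>i) - \<Sum>i=2..v. B\<^sub>i\<close>. The ratio \<open>\<alpha>\<close> is
  chosen such that \<open>G\<^bsub>B'\<^esub>(pmin) = B'\<close>, so no virtual storage exceeds its capacity, and the level
  is at most \<open>B\<^sub>1 = B\<close>.
\<close>

section \<open>The principal branch of the Lambert W function\<close>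

lemma strict_mono_on_times_exp: "strict_mono_on {-1..} (\<lambda>w::real. w * exp w)"
proof (rule strict_mono_onI)
  fix a b :: real
  assume ab: "a \<in> {-1..}" "a < b"
  show "a * exp a < b * exp b"
  \<comment> \<open>The derivative vanishes at \<open>-1\<close>, so a criterion is needed that asks
    for positivity only in the open interval.\<close>
  proof (rule DERIV_pos_imp_increasing_open [OF \<open>a < b\<close>])
    fix x assume "a < x" "x < b"
    have "((\<lambda>w. w * exp w) has_real_derivative (1 + x) * exp x) (at x)"
      by (auto intro!: derivative_eq_intros simp: algebra_simps)
    moreover have "(1 + x) * exp x > 0"
      using ab \<open>a < x\<close> by simp
    ultimately show "\<exists>y. ((\<lambda>w. w * exp w) has_real_derivative y) (at x) \<and> y > 0"
      by blast
  qed (intro continuous_intros)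
qed

lemma lambert_W_eqI:
  assumes "-1 \<le> w" and "w * exp w = x"
  shows "lambert_W x = w"
  unfolding lambert_W_def
proof (rule the_equality)
  fix u assume "-1 \<le> u \<and> u * exp u = x"
  then show "u = w"
    using assms strict_mono_on_eqD [OF strict_mono_on_times_exp, of u w] by auto
qed (use assms in auto)

text \<open>On \<open>[-1, 0]\<close> the function \<open>w * exp w\<close> runs from
  \<open>- exp (-1)\<close> to \<open>0\<close>; the strict bounds on \<open>x\<close> exclude both
  endpoints.\<close>

lemma lambert_W_negative:
  assumes "- exp (-1) < x" and "x < 0"
  shows "-1 < lambert_W x" and "lambert_W x < 0" and "lambert_W x * exp (lambert_W x) = x"
proof -
  have "\<exists>w\<ge>-1. w \<le> 0 \<and> w * exp w = x"
    by (rule IVT') (use assms in \<open>auto intro!: continuous_intros\<close>)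
  then obtain w where w: "-1 \<le> w" "w \<le> 0" "w * exp w = x"
    by blast
  moreover have "w \<noteq> -1" "w \<noteq> 0"
    using w(3) assms by auto
  ultimately show "-1 < lambert_W x" "lambert_W x < 0" "lambert_W x * exp (lambert_W x) = x"
    using lambert_W_eqI [of w x] by auto
qed

lemma reserve_scale: "reserve pmin pmax B' p = B' * reserve pmin pmax 1 p"
  by (simp add: reserve_def Let_def)

text \<open>The capacities from index 2 on are the positive demands since the last reset. The bounds
  on \<open>cap\<close> and \<open>resv\<close> are what \<open>reserve_le_capacity\<close>
  needs.\<close>

definition reserve_inv :: "real \<Rightarrow> real \<Rightarrow> real \<Rightarrow> bm_state \<Rightarrow> bool" where
  "reserve_inv pmin pmax B s \<longleftrightarrow>
     1 \<le> num s \<and> cap s 1 = B \<and> 0 \<le> level s \<and>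
     (\<forall>i\<in>{1..num s}. 0 \<le> cap s i \<and> pmin \<le> resv s i) \<and>
     level s = (\<Sum>i=1..num s. reserve pmin pmax (cap s i) (resv s i)) - (\<Sum>i=2..num s. cap s i)"

section \<open>The ratio \<alpha> and the reservation function\<close>

context
  fixes pmin pmax :: real
  assumes pmin_pos: "0 < pmin" and pmin_less: "pmin < pmax"
begin

text \<open>With \<open>w\<close> the Lambert value in the definition, 1/\<alpha> is
  \<open>w + 1\<close>; multiplying \<open>w * exp w\<close> by \<open>- exp 1\<close> gives the
  equation.\<close>

lemma
  shows comp_ratio_gt_1: "1 < comp_ratio pmin pmax"
    and comp_ratio_eq:
      "(1 - inverse (comp_ratio pmin pmax)) * exp (inverse (comp_ratio pmin pmax)) = 1 - pmin / pmax"
proof -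
  define w where "w = lambert_W (- ((1 - pmin / pmax) * exp (-1)))"
  have "0 < pmin / pmax" "pmin / pmax < 1"
    using pmin_pos pmin_less by auto
  then have w: "-1 < w" "w < 0" "w * exp w = - ((1 - pmin / pmax) * exp (-1))"
    unfolding w_def by (intro lambert_W_negative; simp)+
  have "(pmax / pmin - 1) / (pmax / pmin * exp 1) = (1 - pmin / pmax) * exp (-1)"
    using pmin_pos pmin_less by (simp add: exp_minus divide_simps)
  then have \<alpha>: "comp_ratio pmin pmax = inverse (w + 1)"
    by (simp add: comp_ratio_def w_def)
  show "1 < comp_ratio pmin pmax"
    unfolding \<alpha> using w(1,2) by (intro one_less_inverse) auto
  have "- w * exp (w + 1) = 1 - pmin / pmax"
    using w(3) by (simp add: exp_add exp_minus field_simps)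
  then show "(1 - inverse (comp_ratio pmin pmax)) * exp (inverse (comp_ratio pmin pmax))
      = 1 - pmin / pmax"
    by (simp add: \<alpha>)
qed

text \<open>Puts \<open>pmin\<close> in the logarithmic branch of \<open>reserve\<close> and makes
  the initial reservation price admissible. It follows from \<open>exp c >= 1\<close> in the
  equation for \<alpha>.\<close>

lemma pmin_le_threshold: "pmin \<le> pmax / comp_ratio pmin pmax"
proof -
  define c where "c = inverse (comp_ratio pmin pmax)"
  have "0 < c" "c < 1"
    using comp_ratio_gt_1 by (auto simp: c_def inverse_less_1_iff)
  then have "(1 - c) * 1 \<le> (1 - c) * exp c"
    by (intro mult_left_mono) auto
  also have "\<dots> = 1 - pmin / pmax"
    using comp_ratio_eq by (simp add: c_def)
  finally have "pmin / pmax \<le> c"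
    by simp
  then show ?thesis
    using pmin_pos pmin_less by (simp add: c_def field_simps)
qed

text \<open>The equation for \<alpha> turns the argument of the logarithm into
  \<open>exp (inverse a)\<close>, and the factor \<open>a\<close> cancels.\<close>

lemma reserve_pmin: "reserve pmin pmax 1 pmin = 1"
proof -
  define a where "a = comp_ratio pmin pmax"
  have a: "1 < a" "(1 - inverse a) * exp (inverse a) = 1 - pmin / pmax"
    using comp_ratio_gt_1 comp_ratio_eq by (auto simp: a_def)
  have "(1 - pmin / pmax) * (a / (a - 1)) = exp (inverse a)"
    unfolding a(2) [symmetric] using a(1) by (simp add: field_simps)
  then show ?thesis
    using pmin_le_threshold a(1) by (simp add: reserve_def Let_def flip: a_def)
qed

text \<open>A new or reset virtual storage is empty: the logarithm is taken at 1.\<close>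

lemma reserve_threshold: "reserve pmin pmax B' (pmax / comp_ratio pmin pmax) = 0"
proof -
  define a where "a = comp_ratio pmin pmax"
  have "1 < a" "pmax \<noteq> 0"
    using comp_ratio_gt_1 pmin_pos pmin_less by (auto simp: a_def)
  then have "(1 - pmax / a / pmax) * (a / (a - 1)) = 1"
    by (simp add: field_simps)
  then show ?thesis
    by (simp add: reserve_def Let_def flip: a_def)
qed

lemma reserve_antimono_unit:
  assumes "p \<le> q"
  shows "reserve pmin pmax 1 q \<le> reserve pmin pmax 1 p"
proof -
  define a where "a = comp_ratio pmin pmax"
  have a: "1 < a" and pmax: "0 < pmax"
    using comp_ratio_gt_1 pmin_pos pmin_less by (auto simp: a_def)
  have mono: "reserve pmin pmax 1 r \<le> reserve pmin pmax 1 p" if "p \<le> r" "r \<le> pmax / a" for r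
  proof -
    have "r / pmax \<le> 1 / a"
      using that pmax by (simp add: field_simps)
    also have "\<dots> < 1"
      using a by simp
    finally have "0 < (1 - r / pmax) * (a / (a - 1))"
      using a by simp
    moreover have "(1 - r / pmax) * (a / (a - 1)) \<le> (1 - p / pmax) * (a / (a - 1))"
      using that a pmax by (intro mult_right_mono) (auto simp: divide_right_mono)
    ultimately have "ln ((1 - r / pmax) * (a / (a - 1))) \<le> ln ((1 - p / pmax) * (a / (a - 1)))"
      by (intro ln_mono) auto
    then show ?thesis
      using that a by (simp add: reserve_def Let_def flip: a_def)
  qed
  show ?thesis
  proof (cases "q \<le> pmax / a")
    case True
    then show ?thesis using mono assms by simp
  next
    case False
    then have "reserve pmin pmax 1 q = 0"
      by (simp add: reserve_def Let_def flip: a_def)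
    moreover have "0 \<le> reserve pmin pmax 1 p"
    proof (cases "p \<le> pmax / a")
      case True
      then show ?thesis
        \<comment> \<open>Prices on different sides of the threshold are compared through the
          threshold itself, where \<open>reserve\<close> is 0.\<close>
        using mono [of "pmax / a"] reserve_threshold [of 1] by (simp flip: a_def)
    next
      case False
      then show ?thesis by (simp add: reserve_def Let_def flip: a_def)
    qed
    ultimately show ?thesis by simp
  qed
qed

lemma reserve_antimono:
  assumes "0 \<le> B'" and "p \<le> q"
  shows "reserve pmin pmax B' q \<le> reserve pmin pmax B' p"
  using assms reserve_antimono_unit
  by (simp add: reserve_scale [of _ _ B'] mult_left_mono)

lemma reserve_le_capacity:
  assumes "0 \<le> B'" and "pmin \<le> p"
  shows "reserve pmin pmax B' p \<le> B'"
  using reserve_antimono [OF assms] reserve_scale [of pmin pmax B' pmin] reserve_pmin by simp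

text \<open>By antitonicity the positive part is exactly the gain in virtual content when the
  reservation price drops to the minimum.\<close>

lemma virtual_purchase:
  assumes "0 \<le> B'"
  shows "max 0 (reserve pmin pmax B' p - reserve pmin pmax B' \<xi>)
    = reserve pmin pmax B' (min p \<xi>) - reserve pmin pmax B' \<xi>"
  using reserve_antimono [OF assms, of p \<xi>] reserve_antimono [OF assms, of \<xi> p]
  by (auto simp: min_def max_def)

section \<open>The invariant: start, level bound, preservation\<close>

lemma reserve_inv_init:
  assumes "0 \<le> B"
  shows "reserve_inv pmin pmax B (batman_init pmin pmax B)"
  using assms pmin_le_threshold
  by (simp add: reserve_inv_def batman_init_def reserve_threshold)

lemma reserve_inv_level_le:
  assumes "reserve_inv pmin pmax B s"
  shows "level s \<le> B"
proof -
  have "(\<Sum>i=1..num s. reserve pmin pmax (cap s i) (resv s i)) \<le> (\<Sum>i=1..num s. cap s i)"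
    using assms by (intro sum_mono reserve_le_capacity) (auto simp: reserve_inv_def)
  also have "\<dots> = B + (\<Sum>i=2..num s. cap s i)"
    using assms by (simp add: reserve_inv_def sum.atLeast_Suc_atMost numeral_2_eq_2)
  finally show ?thesis
    using assms by (simp add: reserve_inv_def)
qed

lemma reserve_inv_step:
  assumes inv: "reserve_inv pmin pmax B s" and "0 \<le> B" and "pmin \<le> pt" and "0 \<le> dt"
  shows "reserve_inv pmin pmax B (snd (batman_step pmin pmax pt dt s))"
proof -
  define \<xi>0 where "\<xi>0 = pmax / comp_ratio pmin pmax"
  define v where "v = (if dt > 0 then num s + 1 else num s)"
  define C where "C = (if dt > 0 then (cap s)(v := dt) else cap s)"
  define \<xi> where "\<xi> = (if dt > 0 then (resv s)(v := \<xi>0) else resv s)"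
  define y where "y = (\<lambda>i. max 0 (reserve pmin pmax (C i) pt - reserve pmin pmax (C i) (\<xi> i)))"
  define \<xi>' where "\<xi>' = (\<lambda>i. if i \<in> {1..v} then min pt (\<xi> i) else \<xi> i)"
  define x where "x = max (\<Sum>i=1..v. y i) (max 0 (dt - level s))"
  define b where "b = level s + x - dt"
  have step: "snd (batman_step pmin pmax pt dt s) =
      (if b = 0
       then \<lparr>level = b, num = 1, cap = C, resv = \<xi>'(1 := \<xi>0)\<rparr>
       else \<lparr>level = b, num = v, cap = C, resv = \<xi>'\<rparr>)"
    unfolding batman_step_def Let_def b_def x_def \<xi>'_def y_def \<xi>_def C_def v_def \<xi>0_def by simp
  have n: "1 \<le> num s" and cap1: "cap s 1 = B"
    and bounds: "\<forall>i\<in>{1..num s}. 0 \<le> cap s i \<and> pmin \<le> resv s i"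
    and level: "level s =
      (\<Sum>i=1..num s. reserve pmin pmax (cap s i) (resv s i)) - (\<Sum>i=2..num s. cap s i)"
    using inv by (auto simp: reserve_inv_def)
  \<comment> \<open>A new storage gets an index of at least 2, so storage 1 keeps capacity
    \<open>B\<close>.\<close>
  have v: "1 \<le> v" and C1: "C 1 = B"
    using n cap1 by (auto simp: v_def C_def)
  have bounds': "\<forall>i\<in>{1..v}. 0 \<le> C i \<and> pmin \<le> \<xi> i"
    using bounds \<open>0 \<le> dt\<close> pmin_le_threshold by (auto simp: C_def \<xi>_def v_def \<xi>0_def)
  \<comment> \<open>The level formula after the demand but before the purchase: the new storage is
    empty and its capacity \<open>dt\<close> is subtracted.\<close>
  have level': "level s - dt =
      (\<Sum>i=1..v. reserve pmin pmax (C i) (\<xi> i)) - (\<Sum>i=2..v. C i)"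
  proof (cases "dt > 0")
    case True
    have "(\<Sum>i=1..num s. reserve pmin pmax (C i) (\<xi> i))
        = (\<Sum>i=1..num s. reserve pmin pmax (cap s i) (resv s i))"
      "(\<Sum>i=2..num s. C i) = (\<Sum>i=2..num s. cap s i)"
      using True by (auto intro!: sum.cong simp: C_def \<xi>_def v_def)
    moreover have "v = Suc (num s)" "C v = dt" "\<xi> v = \<xi>0"
      using True by (auto simp: C_def \<xi>_def v_def)
    ultimately show ?thesis
      using n level reserve_threshold by (simp add: \<xi>0_def)
  next
    case False
    then show ?thesis
      using level \<open>0 \<le> dt\<close> by (simp add: C_def \<xi>_def v_def)
  qed
  have "0 \<le> b"
    by (simp add: b_def x_def)
  show ?thesis
  proof (cases "b = 0")
    case True
    then show ?thesis
      using C1 \<open>0 \<le> B\<close> pmin_le_threshold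
      by (simp add: step reserve_inv_def reserve_threshold \<xi>0_def)
  next
    case False
    have "0 \<le> (\<Sum>i=1..v. y i)"
      by (intro sum_nonneg) (simp add: y_def)
    \<comment> \<open>If \<open>dt - level s\<close> exceeded the sum and 0, it would be the
      purchase and force \<open>b = 0\<close>.\<close>
    then have "x = (\<Sum>i=1..v. y i)"
      using False by (auto simp: b_def x_def max_def split: if_splits)
    also have "\<dots> = (\<Sum>i=1..v. reserve pmin pmax (C i) (\<xi>' i) - reserve pmin pmax (C i) (\<xi> i))"
      using bounds' by (intro sum.cong) (auto simp: y_def \<xi>'_def virtual_purchase)
    finally have "b = (\<Sum>i=1..v. reserve pmin pmax (C i) (\<xi>' i)) - (\<Sum>i=2..v. C i)"
      using level' by (simp add: b_def sum_subtractf)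
    then show ?thesis
      using False \<open>0 \<le> b\<close> v C1 bounds' \<open>pmin \<le> pt\<close>
      by (simp add: step reserve_inv_def \<xi>'_def)
  qed
qed

end

section \<open>From the state of the algorithm to feasibility\<close>

lemma level_batman_step:
  "level (snd (batman_step pmin pmax pt dt s)) = level s + fst (batman_step pmin pmax pt dt s) - dt"
  by (simp add: batman_step_def Let_def)

lemma batman_step_purchase:
  "0 \<le> fst (batman_step pmin pmax pt dt s)" "dt - level s \<le> fst (batman_step pmin pmax pt dt s)"
  by (simp_all add: batman_step_def Let_def)

lemma inventory_batman:
  "inventory d (batman pmin pmax B p d) t = level (batman_state pmin pmax B p d t)"
  by (induction t) (simp_all add: level_batman_step batman_def batman_init_def)

theorem theorem3p1:
  fixes pmin pmax B :: real and T :: nat and p d :: "nat \<Rightarrow> real"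
  assumes "0 < pmin" and "pmin < pmax" and "0 < B"
    and "\<And>t. t \<in> {1..T} \<Longrightarrow> p t \<in> {pmin..pmax}"
    and "\<And>t. t \<in> {1..T} \<Longrightarrow> 0 \<le> d t"
  shows "feasible B T d (batman pmin pmax B p d)"
proof -
  \<comment> \<open>Restricted to \<open>t \<le> T\<close> because prices and demands are
    constrained only up to \<open>T\<close>.\<close>
  have inv: "reserve_inv pmin pmax B (batman_state pmin pmax B p d t)" if "t \<le> T" for t
    using that
  proof (induction t)
    case 0
    then show ?case
      using assms by (simp add: reserve_inv_init)
  next
    case (Suc t)
    then show ?case
      using assms by (auto intro!: reserve_inv_step)
  qed
  have "0 \<le> level (batman_state pmin pmax B p d t) \<and> level (batman_state pmin pmax B p d t) \<le> B"
    if "t \<in> {1..T}" for t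
    using that inv [of t] reserve_inv_level_le [OF assms(1,2), of B]
    by (auto simp: reserve_inv_def)
  then show ?thesis
    by (auto simp: feasible_def inventory_batman batman_step_purchase batman_def)
qed

end
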